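(* $\mathsf{HATL}\prec\mathsf{ALAMB}$ and $\mathsf{SLAMB}\prec\mathsf{ALAMB}$: every formula of $\mathsf{HATL}$ (resp. $\mathsf{SLAMB}$) is equivalent to some formula of $\mathsf{ALAMB}$, but there is a formula of $\mathsf{ALAMB}$ not equivalent to any formula of $\mathsf{HATL}$ (resp. $\mathsf{SLAMB}$).
   Context: Fix a non-empty finite set of agents $\mathit{Agt}=\{1,\dots,n\}$, a non-empty finite set of actions $\mathit{Act}$, and disjoint countably infinite sets $\mathit{Prop}$ (atomic propositions) and $\mathit{Nom}$ (nominals). A coalition is a subset $C\subseteq\mathit{Agt}$; complete action profiles are elements of $\mathit{Act}^{\mathit{Agt}}$. A named concurrent game model (CGM) is $M=\langle S,\tau,L\rangle$ with $S$ a non-empty finite set of states, $\tau:S\times\mathit{Act}^{\mathit{Agt}}\to S$, and $L:\mathit{Prop}\cup\mathit{Nom}\to 2^S$ such that $|L(\alpha)|\le 1$ for all $\alpha\in\mathit{Nom}$ and every state $s$ has $L(\alpha)=\{s\}$ for some $\alpha\in\mathit{Nom}$. $M_s$ is $M$ with designated state $s$. For a profile $A_C\in\mathit{Act}^C$, $\tau(s,A_C)$ is the set of $\tau(s,A)$ over complete profiles $A$ extending $A_C$. A memoryless strategy $\sigma_C$ assigns an action to each agent of $C$ at each state; $\Lambda^s_{\sigma_C}$ is the set of infinite state sequences $\lambda$ with $\lambda[0]=s$ and $\lambda[i+1]\in\tau(\lambda[i],\sigma_C(\lambda[i]))$. $\mathsf{HATL}$: $\varphi::=p\mid\alpha\mid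 @_\alpha\varphi\mid\neg\varphi\mid\varphi\wedge\varphi\mid\langle\!\langle C\rangle\!\rangle\mathsf{X}\varphi\mid\langle\!\langle C\rangle\!\rangle\varphi\mathsf{U}\varphi\mid\langle\!\langle C\rangle\!\rangle\varphi\mathsf{R}\varphi$. Semantics: $M_s\models p$ iff $s\in L(p)$; $M_s\models\alpha$ iff $s\in L(\alpha)$; $M_s\models@_\alpha\varphi$ iff $L(\alpha)=\{t\}$ for some $t$ with $M_t\models\varphi$; Booleans standard; $M_s\models\langle\!\langle C\rangle\!\rangle\mathsf{X}\varphi$ iff $\exists\sigma_C\forall\lambda\in\Lambda^s_{\sigma_C}:M_{\lambda[1]}\models\varphi$; $M_s\models\langle\!\langle C\rangle\!\rangle\psi\mathsf{U}\varphi$ iff $\exists\sigma_C\forall\lambda\in\Lambda^s_{\sigma_C}\exists i\ge0$: $M_{\lambda[i]}\models\varphi$ and $M_{\lambda[j]}\models\psi$ for all $j<i$; $M_s\models\langle\!\langle C\rangle\!\rangle\psi\mathsf{R}\varphi$ iff $\exists\sigma_C\forall\lambda\in\Lambda^s_{\sigma_C}\forall i\ge0$: $M_{\lambda[i]}\models\varphi$ or $M_{\lambda[j]}\models\psi$ for some $j\le i$. $\mathsf{SLAMB}$ extends $\mathsf{HATL}$ with $[p_\alpha:=\psi]\varphi$: $M_s\models[p_\alpha:=\psi]\varphi$ iff $M^{p_\alpha:=\psi}_s\models\varphi$, where if $L(\alpha)=\{t\}$ the valuation of $p$ is changed only at $t$, making $p$ true at $t$ iff $M_s\models\psi$ (everything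 else unchanged), and if $L(\alpha)=\emptyset$ the model is unchanged. $\mathsf{ALAMB}$ extends $\mathsf{HATL}$ with $[\alpha\xrightarrow{A}\beta]\varphi$ ($\alpha,\beta\in\mathit{Nom}$, $A\in\mathit{Act}^{\mathit{Agt}}$): $M_s\models[\alpha\xrightarrow{A}\beta]\varphi$ iff $M^{\alpha\xrightarrow{A}\beta}_s\models\varphi$, where if $L(\alpha)=\{u\}$ and $L(\beta)=\{t\}$ then $M^{\alpha\xrightarrow{A}\beta}=\langle S,\tau',L\rangle$ with $\tau'(u,A)=t$ and $\tau'(s',A')=\tau(s',A')$ for all other pairs $(s',A')$; otherwise the model is unchanged. Two formulas are equivalent if they hold in exactly the same pointed CGMs $M_s$. $\mathsf L_1\preccurlyeq\mathsf L_2$ means every formula of $\mathsf L_1$ has an equivalent formula in $\mathsf L_2$; $\mathsf L_1\prec\mathsf L_2$ means $\mathsf L_1\preccurlyeq\mathsf L_2$ and not $\mathsf L_2\preccurlyeq\mathsf L_1$.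
   Formalization: Strictness is stated only for at least two actions: with a single action every model is a functional graph, arrow updates can be eliminated, ALAMB is no more expressive than HATL, and both strict claims fail. The non-strict inclusions are stated without restriction. *)

theory Defs
  imports "HOL-Library.Countable" "HOL-Library.Infinite_Typeclass"
begin

text \<open>
  Agents and actions are the types \<open>'g\<close> and \<open>'c\<close> (non-empty, and finite in the main statement);
  a complete action profile is a function \<open>'g \<Rightarrow> 'c\<close>. Propositions and nominals are the types
  \<open>'p\<close> and \<open>'n\<close>, and their disjoint union is the sum type \<open>'p + 'n\<close>.
\<close>

subsection \<open>Named concurrent game models\<close>

record ('g, 'c, 'p, 'n, 's) cgm =
  states :: "'s set"
  step :: "'s \<Rightarrow> ('g \<Rightarrow> 'c) \<Rightarrow> 's"
  label :: "'p + 'n \<Rightarrow> 's set"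

definition named_cgm :: "('g, 'c, 'p, 'n, 's) cgm \<Rightarrow> bool" where
  "named_cgm M \<longleftrightarrow>
     finite (states M) \<and> states M \<noteq> {} \<and>
     (\<forall>s\<in>states M. \<forall>A. step M s A \<in> states M) \<and>
     (\<forall>x. label M x \<subseteq> states M) \<and>
     (\<forall>a. card (label M (Inr a)) \<le> 1) \<and>
     (\<forall>s\<in>states M. \<exists>a. label M (Inr a) = {s})"

text \<open>
  A profile of a coalition \<open>C\<close> is represented by a total function whose values outside \<open>C\<close>
  are ignored; the same holds for memoryless strategies of \<open>C\<close>, which have
  type \<open>'s \<Rightarrow> 'g \<Rightarrow> 'c\<close>.
\<close>

definition outcomes :: "('g, 'c, 'p, 'n, 's) cgm \<Rightarrow> 'g set \<Rightarrow> 's \<Rightarrow> ('g \<Rightarrow> 'c) \<Rightarrow> 's set" where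
  "outcomes M C s A = {step M s B | B. \<forall>i\<in>C. B i = A i}"

definition plays :: "('g, 'c, 'p, 'n, 's) cgm \<Rightarrow> 'g set \<Rightarrow> 's \<Rightarrow> ('s \<Rightarrow> 'g \<Rightarrow> 'c) \<Rightarrow> (nat \<Rightarrow> 's) set" where
  "plays M C s \<sigma> = {l. l 0 = s \<and> (\<forall>i. l (Suc i) \<in> outcomes M C (l i) (\<sigma> (l i)))}"

subsection \<open>Model updates\<close>

text \<open>In \<open>assign_model M p a b\<close>, the truth value \<open>b\<close> is that of the assigned formula at the
  point of evaluation, not at the state named by \<open>a\<close>.\<close>

definition assign_model ::
  "('g, 'c, 'p, 'n, 's) cgm \<Rightarrow> 'p \<Rightarrow> 'n \<Rightarrow> bool \<Rightarrow> ('g, 'c, 'p, 'n, 's) cgm" where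
  "assign_model M p a b =
     (if is_singleton (label M (Inr a))
      then let t = the_elem (label M (Inr a)) in
        M\<lparr>label := (label M)(Inl p :=
            (if b then insert t (label M (Inl p)) else label M (Inl p) - {t}))\<rparr>
      else M)"

definition redirect_model ::
  "('g, 'c, 'p, 'n, 's) cgm \<Rightarrow> 'n \<Rightarrow> ('g \<Rightarrow> 'c) \<Rightarrow> 'n \<Rightarrow> ('g, 'c, 'p, 'n, 's) cgm" where
  "redirect_model M a A b =
     (if is_singleton (label M (Inr a)) \<and> is_singleton (label M (Inr b))
      then let u = the_elem (label M (Inr a)); t = the_elem (label M (Inr b)) in
        M\<lparr>step := (step M)(u := (step M u)(A := t))\<rparr>
      else M)"

subsection \<open>Syntax and semantics\<close>

text \<open>One datatype contains all formulas; the individual languages are the fragments below.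
  \<open>Assign p a \<psi> \<phi>\<close> is \<open>[p\<^sub>a := \<psi>]\<phi>\<close>, and \<open>Redirect a A b \<phi>\<close> is the operator redirecting the
  \<open>A\<close>-transition of the state named \<open>a\<close> to the state named \<open>b\<close>.\<close>

datatype ('g, 'c, 'p, 'n) formula =
    Prop 'p
  | Nom 'n
  | At 'n "('g, 'c, 'p, 'n) formula"
  | Neg "('g, 'c, 'p, 'n) formula"
  | Conj "('g, 'c, 'p, 'n) formula" "('g, 'c, 'p, 'n) formula"
  | Next "'g set" "('g, 'c, 'p, 'n) formula"
  | Until "'g set" "('g, 'c, 'p, 'n) formula" "('g, 'c, 'p, 'n) formula"
  | Release "'g set" "('g, 'c, 'p, 'n) formula" "('g, 'c, 'p, 'n) formula"
  | Assign 'p 'n "('g, 'c, 'p, 'n) formula" "('g, 'c, 'p, 'n) formula"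
  | Redirect 'n "'g \<Rightarrow> 'c" 'n "('g, 'c, 'p, 'n) formula"

primrec sat :: "('g, 'c, 'p, 'n, 's) cgm \<Rightarrow> 's \<Rightarrow> ('g, 'c, 'p, 'n) formula \<Rightarrow> bool" where
  "sat M s (Prop p) \<longleftrightarrow> s \<in> label M (Inl p)"
| "sat M s (Nom a) \<longleftrightarrow> s \<in> label M (Inr a)"
| "sat M s (At a \<phi>) \<longleftrightarrow> (\<exists>t. label M (Inr a) = {t} \<and> sat M t \<phi>)"
| "sat M s (Neg \<phi>) \<longleftrightarrow> \<not> sat M s \<phi>"
| "sat M s (Conj \<phi> \<psi>) \<longleftrightarrow> sat M s \<phi> \<and> sat M s \<psi>"
| "sat M s (Next C \<phi>) \<longleftrightarrow> (\<exists>\<sigma>. \<forall>l\<in>plays M C s \<sigma>. sat M (l 1) \<phi>)"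
| "sat M s (Until C \<psi> \<phi>) \<longleftrightarrow>
     (\<exists>\<sigma>. \<forall>l\<in>plays M C s \<sigma>. \<exists>i. sat M (l i) \<phi> \<and> (\<forall>j<i. sat M (l j) \<psi>))"
| "sat M s (Release C \<psi> \<phi>) \<longleftrightarrow>
     (\<exists>\<sigma>. \<forall>l\<in>plays M C s \<sigma>. \<forall>i. sat M (l i) \<phi> \<or> (\<exists>j\<le>i. sat M (l j) \<psi>))"
| "sat M s (Assign p a \<psi> \<phi>) \<longleftrightarrow> sat (assign_model M p a (sat M s \<psi>)) s \<phi>"
| "sat M s (Redirect a A b \<phi>) \<longleftrightarrow> sat (redirect_model M a A b) s \<phi>"

primrec assign_free :: "('g, 'c, 'p, 'n) formula \<Rightarrow> bool" where
  "assign_free (Prop p) \<longleftrightarrow> True"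
| "assign_free (Nom a) \<longleftrightarrow> True"
| "assign_free (At a \<phi>) \<longleftrightarrow> assign_free \<phi>"
| "assign_free (Neg \<phi>) \<longleftrightarrow> assign_free \<phi>"
| "assign_free (Conj \<phi> \<psi>) \<longleftrightarrow> assign_free \<phi> \<and> assign_free \<psi>"
| "assign_free (Next C \<phi>) \<longleftrightarrow> assign_free \<phi>"
| "assign_free (Until C \<psi> \<phi>) \<longleftrightarrow> assign_free \<psi> \<and> assign_free \<phi>"
| "assign_free (Release C \<psi> \<phi>) \<longleftrightarrow> assign_free \<psi> \<and> assign_free \<phi>"
| "assign_free (Assign p a \<psi> \<phi>) \<longleftrightarrow> False"
| "assign_free (Redirect a A b \<phi>) \<longleftrightarrow> assign_free \<phi>"

primrec redirect_free :: "('g, 'c, 'p, 'n) formula \<Rightarrow> bool" where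
  "redirect_free (Prop p) \<longleftrightarrow> True"
| "redirect_free (Nom a) \<longleftrightarrow> True"
| "redirect_free (At a \<phi>) \<longleftrightarrow> redirect_free \<phi>"
| "redirect_free (Neg \<phi>) \<longleftrightarrow> redirect_free \<phi>"
| "redirect_free (Conj \<phi> \<psi>) \<longleftrightarrow> redirect_free \<phi> \<and> redirect_free \<psi>"
| "redirect_free (Next C \<phi>) \<longleftrightarrow> redirect_free \<phi>"
| "redirect_free (Until C \<psi> \<phi>) \<longleftrightarrow> redirect_free \<psi> \<and> redirect_free \<phi>"
| "redirect_free (Release C \<psi> \<phi>) \<longleftrightarrow> redirect_free \<psi> \<and> redirect_free \<phi>"
| "redirect_free (Assign p a \<psi> \<phi>) \<longleftrightarrow> redirect_free \<psi> \<and> redirect_free \<phi>"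
| "redirect_free (Redirect a A b \<phi>) \<longleftrightarrow> False"

definition HATL :: "('g, 'c, 'p, 'n) formula set" where
  "HATL = {\<phi>. assign_free \<phi> \<and> redirect_free \<phi>}"

definition SLAMB :: "('g, 'c, 'p, 'n) formula set" where
  "SLAMB = {\<phi>. redirect_free \<phi>}"

definition ALAMB :: "('g, 'c, 'p, 'n) formula set" where
  "ALAMB = {\<phi>. assign_free \<phi>}"

subsection \<open>Expressivity\<close>

text \<open>Models range over those with states in \<^typ>\<open>nat\<close>. As models are finite, this is no
  restriction; see \<open>equivalent_universe\<close> below.\<close>

definition equivalent :: "('g, 'c, 'p, 'n) formula \<Rightarrow> ('g, 'c, 'p, 'n) formula \<Rightarrow> bool" where
  "equivalent \<phi> \<psi> \<longleftrightarrow>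
     (\<forall>M :: ('g, 'c, 'p, 'n, nat) cgm. named_cgm M \<longrightarrow>
        (\<forall>s\<in>states M. sat M s \<phi> \<longleftrightarrow> sat M s \<psi>))"

definition at_most_as_expressive ::
  "('g, 'c, 'p, 'n) formula set \<Rightarrow> ('g, 'c, 'p, 'n) formula set \<Rightarrow> bool"
  (infix "\<preceq>" 50) where
  "L\<^sub>1 \<preceq> L\<^sub>2 \<longleftrightarrow> (\<forall>\<phi>\<in>L\<^sub>1. \<exists>\<psi>\<in>L\<^sub>2. equivalent \<phi> \<psi>)"

definition less_expressive ::
  "('g, 'c, 'p, 'n) formula set \<Rightarrow> ('g, 'c, 'p, 'n) formula set \<Rightarrow> bool"
  (infix "\<prec>" 50) where
  "L\<^sub>1 \<prec> L\<^sub>2 \<longleftrightarrow> L\<^sub>1 \<preceq> L\<^sub>2 \<and> \<not> L\<^sub>2 \<preceq> L\<^sub>1"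

text \<open>With a single action, a model is just a functional graph, and redirections can be
  eliminated; \<open>ALAMB\<close> is then as expressive as \<open>HATL\<close>. Strictness needs at least two actions.\<close>

subsection \<open>Independence of the universe of states\<close>

definition iso :: "('s \<Rightarrow> 't) \<Rightarrow> ('g, 'c, 'p, 'n, 's) cgm \<Rightarrow> ('g, 'c, 'p, 'n, 't) cgm \<Rightarrow> bool" where
  "iso h M N \<longleftrightarrow> inj_on h (states M) \<and> states N = h ` states M \<and>
     (\<forall>s\<in>states M. \<forall>A. step M s A \<in> states M \<and> step N (h s) A = h (step M s A)) \<and>
     (\<forall>x. label M x \<subseteq> states M \<and> label N x = h ` label M x)"

lemma plays_in_states:
  assumes "iso h M N" "s \<in> states M" "l \<in> plays M C s \<sigma>"
  shows "l i \<in> states M"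
  using assms by (induction i) (auto simp: plays_def outcomes_def iso_def, metis)

lemma iso_outcomes:
  assumes "iso h M N" "s \<in> states M"
  shows "outcomes N C (h s) A = h ` outcomes M C s A"
  using assms by (auto simp: outcomes_def iso_def)

lemma iso_plays:
  assumes "iso h M N" "s \<in> states M"
  shows "plays N C (h s) \<sigma> = (\<lambda>l. h \<circ> l) ` plays M C s (\<sigma> \<circ> h)"
proof (intro equalityI subsetI)
  fix l assume l: "l \<in> plays N C (h s) \<sigma>"
  have inj: "inj_on h (states M)" using assms by (simp add: iso_def)
  have out: "outcomes M C t A \<subseteq> states M" if "t \<in> states M" for t A
    using assms that by (auto simp: outcomes_def iso_def)
  let ?g = "inv_into (states M) h"
  have im: "l i \<in> h ` states M" for i
  proof (induction i)
    case 0 then show ?case using l assms by (simp add: plays_def)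
  next
    case (Suc i)
    then obtain t where t: "t \<in> states M" "l i = h t" by auto
    have "l (Suc i) \<in> outcomes N C (h t) (\<sigma> (h t))"
      using l t(2)[symmetric] by (simp add: plays_def)
    then show ?case using iso_outcomes[OF assms(1) t(1)] out[OF t(1)] by blast
  qed
  have hg: "h (?g (l i)) = l i" and gS: "?g (l i) \<in> states M" for i
    using im[of i] by (auto simp: f_inv_into_f inv_into_into)
  have "?g \<circ> l \<in> plays M C s (\<sigma> \<circ> h)"
  proof -
    have "?g (l 0) = s" using l assms(2) inj by (simp add: plays_def)
    moreover have "?g (l (Suc i)) \<in> outcomes M C (?g (l i)) (\<sigma> (h (?g (l i))))" for i
    proof -
      have "l (Suc i) \<in> outcomes N C (h (?g (l i))) (\<sigma> (l i))"
        using l by (simp add: plays_def hg)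
      then obtain t where t: "t \<in> outcomes M C (?g (l i)) (\<sigma> (l i))" "l (Suc i) = h t"
        using iso_outcomes[OF assms(1) gS] by auto
      then have "?g (l (Suc i)) = t" using subsetD[OF out[OF gS] t(1)] inj by (simp add: inv_into_f_f)
      then show ?thesis using t hg by simp
    qed
    ultimately show ?thesis by (simp add: plays_def)
  qed
  moreover have "l = h \<circ> (?g \<circ> l)" using hg by (simp add: fun_eq_iff)
  ultimately show "l \<in> (\<lambda>l. h \<circ> l) ` plays M C s (\<sigma> \<circ> h)" by blast
next
  fix l assume "l \<in> (\<lambda>l. h \<circ> l) ` plays M C s (\<sigma> \<circ> h)"
  then obtain k where k: "k \<in> plays M C s (\<sigma> \<circ> h)" "l = h \<circ> k" by auto
  have "k i \<in> states M" for i using plays_in_states[OF assms k(1)] .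
  then show "l \<in> plays N C (h s) \<sigma>"
    using k iso_outcomes[OF assms(1)] by (auto simp: plays_def)
qed

lemma iso_strategy:
  assumes "iso h M N" "s \<in> states M"
    and "\<And>l. (\<And>i. l i \<in> states M) \<Longrightarrow> P l \<longleftrightarrow> Q (h \<circ> l)"
  shows "(\<exists>\<sigma>. \<forall>l\<in>plays M C s \<sigma>. P l) \<longleftrightarrow> (\<exists>\<sigma>. \<forall>l\<in>plays N C (h s) \<sigma>. Q l)"
proof
  assume "\<exists>\<sigma>. \<forall>l\<in>plays M C s \<sigma>. P l"
  then obtain \<sigma> where \<sigma>: "\<forall>l\<in>plays M C s \<sigma>. P l" ..
  define \<rho> where "\<rho> = \<sigma> \<circ> inv_into (states M) h"
  have *: "(\<rho> \<circ> h) t = \<sigma> t" if "t \<in> states M" for t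
    using that assms(1) by (simp add: \<rho>_def iso_def)
  have "l \<in> plays M C s \<sigma>" if "l \<in> plays M C s (\<rho> \<circ> h)" for l
    using that plays_in_states[OF assms(1,2) that] * by (simp add: plays_def)
  then have "\<forall>l\<in>plays N C (h s) \<rho>. Q l"
    using \<sigma> assms(3) plays_in_states[OF assms(1,2)] by (auto simp: iso_plays[OF assms(1,2)])
  then show "\<exists>\<sigma>. \<forall>l\<in>plays N C (h s) \<sigma>. Q l" by (rule exI[of _ \<rho>])
next
  assume "\<exists>\<sigma>. \<forall>l\<in>plays N C (h s) \<sigma>. Q l"
  then obtain \<sigma> where \<sigma>: "\<forall>l\<in>plays N C (h s) \<sigma>. Q l" ..
  then have "\<forall>l\<in>plays M C s (\<sigma> \<circ> h). P l"
    using assms(3) plays_in_states[OF assms(1,2)] by (auto simp: iso_plays[OF assms(1,2)])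
  then show "\<exists>\<sigma>. \<forall>l\<in>plays M C s \<sigma>. P l" by blast
qed

lemma iso_singleton:
  assumes "iso h M N"
  shows "label N x = {u} \<longleftrightarrow> (\<exists>t\<in>states M. u = h t \<and> label M x = {t})"
proof -
  have sub: "label N x = h ` label M x" "label M x \<subseteq> states M" and inj: "inj_on h (states M)"
    using assms by (auto simp: iso_def)
  show ?thesis
  proof
    assume *: "label N x = {u}"
    then obtain t where t: "t \<in> label M x" "u = h t" using sub(1) by blast
    have "y = t" if "y \<in> label M x" for y
    proof -
      have "h y = h t" using that t * sub(1) by blast
      then show ?thesis using inj sub(2) that t(1) by (meson inj_onD subsetD)
    qed
    then show "\<exists>t\<in>states M. u = h t \<and> label M x = {t}" using t sub(2) by blast
  next
    assume "\<exists>t\<in>states M. u = h t \<and> label M x = {t}"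
    then show "label N x = {u}" using sub(1) by auto
  qed
qed

lemma iso_assign:
  assumes "iso h M N"
  shows "iso h (assign_model M p a b) (assign_model N p a b)"
proof (cases "\<exists>t. label M (Inr a) = {t}")
  case True
  then obtain t where t: "label M (Inr a) = {t}" ..
  then have t': "label N (Inr a) = {h t}" "t \<in> states M"
    using assms by (auto simp: iso_def) blast
  have "h ` (label M (Inl p) - {t}) = h ` label M (Inl p) - {h t}"
    using assms t' unfolding iso_def inj_on_def by blast
  then show ?thesis using assms t t'
    by (auto simp: assign_model_def iso_def Let_def)
next
  case False
  then have "\<not> (\<exists>t. label N (Inr a) = {t})" using iso_singleton[OF assms] by auto
  then show ?thesis using False assms by (auto simp: assign_model_def is_singleton_def)
qed

lemma iso_redirect:
  assumes "iso h M N"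
  shows "iso h (redirect_model M a A b) (redirect_model N a A b)"
proof (cases "\<exists>u t. label M (Inr a) = {u} \<and> label M (Inr b) = {t}")
  case True
  then obtain u t where t: "label M (Inr a) = {u}" "label M (Inr b) = {t}" by blast
  then have t': "label N (Inr a) = {h u}" "u \<in> states M" "label N (Inr b) = {h t}" "t \<in> states M"
    using assms by (auto simp: iso_def) blast+
  have "h s = h u \<longleftrightarrow> s = u" if "s \<in> states M" for s
    using assms t' that by (auto simp: iso_def inj_on_def)
  then show ?thesis using assms t t'
    by (auto simp: redirect_model_def iso_def Let_def)
next
  case False
  then have "\<not> (\<exists>u t. label N (Inr a) = {u} \<and> label N (Inr b) = {t})"
    using iso_singleton[OF assms] by metis
  then show ?thesis using False assms by (auto simp: redirect_model_def is_singleton_def)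
qed

lemma states_update [simp]:
  "states (assign_model M p a b) = states M"
  "states (redirect_model M a A b') = states M"
  by (auto simp: assign_model_def redirect_model_def Let_def)

lemma iso_sat:
  assumes "iso h M N" "s \<in> states M"
  shows "sat M s \<phi> \<longleftrightarrow> sat N (h s) \<phi>"
  using assms
proof (induction \<phi> arbitrary: M N s)
  case (Prop p)
  then have "h s \<in> h ` label M (Inl p) \<longleftrightarrow> s \<in> label M (Inl p)"
    by (intro inj_on_image_mem_iff[of h "states M"]) (auto simp: iso_def)
  then show ?case using Prop by (simp add: iso_def)
next
  case (Nom a)
  then have "h s \<in> h ` label M (Inr a) \<longleftrightarrow> s \<in> label M (Inr a)"
    by (intro inj_on_image_mem_iff[of h "states M"]) (auto simp: iso_def)
  then show ?case using Nom by (simp add: iso_def)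
next
  case (At a \<phi>)
  have "t \<in> states M" if "label M (Inr a) = {t}" for t
    using that At.prems unfolding iso_def by blast
  then show ?case
    using At.IH[OF At.prems(1)] by (auto simp: iso_singleton[OF At.prems(1)])
next
  case (Neg \<phi>) then show ?case by simp
next
  case (Conj \<phi> \<psi>) then show ?case by simp
next
  case (Next C \<phi>)
  show ?case unfolding sat.simps
    using Next.IH[OF Next.prems(1)] by (intro iso_strategy[OF Next.prems]) simp
next
  case (Until C \<psi> \<phi>)
  show ?case unfolding sat.simps
    using Until.IH[OF Until.prems(1)] by (intro iso_strategy[OF Until.prems]) simp
next
  case (Release C \<psi> \<phi>)
  show ?case unfolding sat.simps
    using Release.IH[OF Release.prems(1)] by (intro iso_strategy[OF Release.prems]) simp
next
  case (Assign p a \<psi> \<phi>)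
  have "sat M s \<psi> = sat N (h s) \<psi>" using Assign by blast
  then show ?case using Assign.IH(2)[OF iso_assign[OF Assign.prems(1)]] Assign.prems(2) by simp
next
  case (Redirect a A b \<phi>)
  show ?case using Redirect.IH[OF iso_redirect[OF Redirect.prems(1)]] Redirect.prems(2) by simp
qed

lemma equivalent_universe:
  fixes M :: "('g, 'c, 'p, 'n, 's) cgm"
  assumes "equivalent \<phi> \<psi>" "named_cgm M" "s \<in> states M"
  shows "sat M s \<phi> \<longleftrightarrow> sat M s \<psi>"
proof -
  have fin: "finite (states M)" using assms(2) by (simp add: named_cgm_def)
  then obtain h :: "'s \<Rightarrow> nat" where inj: "inj_on h (states M)"
    using finite_imp_inj_to_nat_seg[OF fin] by auto
  define N :: "('g, 'c, 'p, 'n, nat) cgm" where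
    "N = \<lparr>states = h ` states M, step = (\<lambda>x A. h (step M (inv_into (states M) h x) A)),
          label = (\<lambda>x. h ` label M x)\<rparr>"
  have iso: "iso h M N"
    using assms(2) inj by (auto simp: iso_def N_def named_cgm_def)
  have "named_cgm N"
    unfolding named_cgm_def
  proof (intro conjI)
    show "\<forall>a. card (label N (Inr a)) \<le> 1"
    proof
      fix a
      have "label M (Inr a) \<subseteq> states M" "card (label M (Inr a)) \<le> 1"
        using assms(2) by (simp_all add: named_cgm_def)
      moreover from this fin have "finite (label M (Inr a))" by (simp add: finite_subset)
      ultimately show "card (label N (Inr a)) \<le> 1"
        using card_image_le[of "label M (Inr a)" h] by (simp add: N_def)
    qed
    show "\<forall>s\<in>states N. \<exists>a. label N (Inr a) = {s}"
    proof
      fix u assume "u \<in> states N"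
      then obtain t where t: "t \<in> states M" "u = h t" by (auto simp: N_def)
      then obtain a where "label M (Inr a) = {t}"
        using assms(2) unfolding named_cgm_def by blast
      then show "\<exists>a. label N (Inr a) = {u}" using t by (intro exI[of _ a]) (simp add: N_def)
    qed
    show "\<forall>x. label N x \<subseteq> states N"
      using assms(2) by (simp add: N_def named_cgm_def image_mono)
    show "finite (states N)" "states N \<noteq> {}"
      using assms(2) by (simp_all add: N_def named_cgm_def)
    show "\<forall>u\<in>states N. \<forall>A. step N u A \<in> states N"
      using assms(2) inj by (simp add: N_def named_cgm_def)
  qed
  moreover have "h s \<in> states N" using assms(3) by (simp add: N_def)
  ultimately have "sat N (h s) \<phi> \<longleftrightarrow> sat N (h s) \<psi>"
    using assms(1) unfolding equivalent_def by blast
  then show ?thesis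
    unfolding iso_sat[OF iso assms(3)] .
qed

end

theory Submission
  imports Defs
begin

text \<open>
  Assignments are eliminated outright: since the value of \<open>\<psi>\<close> at the point of evaluation is a fixed
  truth value, \<open>[p\<^sub>a := \<psi>]\<phi>\<close> is a case distinction on \<open>\<psi>\<close> between \<open>\<phi>\<close> with \<open>p \<or> a\<close> for \<open>p\<close>
  and \<open>\<phi>\<close> with \<open>p \<and> \<not> a\<close> for \<open>p\<close>. So \<open>SLAMB\<close> is no more expressive than \<open>HATL\<close>.
  Strictness holds because \<open>HATL\<close> cannot see the names of the actions: its formulas are invariant
  under permutations of the actions, whereas a redirection refers to a concrete profile.
\<close>

lemma at_most_as_expressive_trans:
  assumes "L\<^sub>1 \<preceq> L\<^sub>2" "L\<^sub>2 \<preceq> L\<^sub>3"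
  shows "L\<^sub>1 \<preceq> L\<^sub>3"
  using assms unfolding at_most_as_expressive_def equivalent_def by meson

lemma at_most_as_expressive_mono: "L\<^sub>1 \<subseteq> L\<^sub>2 \<Longrightarrow> L\<^sub>1 \<preceq> L\<^sub>2"
  unfolding at_most_as_expressive_def equivalent_def by blast

subsection \<open>Elimination of assignments\<close>

text \<open>Meant for \<open>HATL\<close> formulas only; below an update operator nothing is substituted.\<close>

primrec subst_prop ::
  "'p \<Rightarrow> ('g, 'c, 'p, 'n) formula \<Rightarrow> ('g, 'c, 'p, 'n) formula \<Rightarrow> ('g, 'c, 'p, 'n) formula" where
  "subst_prop p \<chi> (Prop q) = (if q = p then \<chi> else Prop q)"
| "subst_prop p \<chi> (Nom a) = Nom a"
| "subst_prop p \<chi> (At a \<phi>) = At a (subst_prop p \<chi> \<phi>)"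
| "subst_prop p \<chi> (Neg \<phi>) = Neg (subst_prop p \<chi> \<phi>)"
| "subst_prop p \<chi> (Conj \<phi> \<psi>) = Conj (subst_prop p \<chi> \<phi>) (subst_prop p \<chi> \<psi>)"
| "subst_prop p \<chi> (Next C \<phi>) = Next C (subst_prop p \<chi> \<phi>)"
| "subst_prop p \<chi> (Until C \<psi> \<phi>) = Until C (subst_prop p \<chi> \<psi>) (subst_prop p \<chi> \<phi>)"
| "subst_prop p \<chi> (Release C \<psi> \<phi>) = Release C (subst_prop p \<chi> \<psi>) (subst_prop p \<chi> \<phi>)"
| "subst_prop p \<chi> (Assign q a \<psi> \<phi>) = Assign q a \<psi> \<phi>"
| "subst_prop p \<chi> (Redirect a A b \<phi>) = Redirect a A b \<phi>"

lemma subst_prop_HATL: "\<phi> \<in> HATL \<Longrightarrow> \<chi> \<in> HATL \<Longrightarrow> subst_prop p \<chi> \<phi> \<in> HATL"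
  by (induction \<phi>) (auto simp: HATL_def)

lemma plays_label_update [simp]: "plays (M\<lparr>label := V\<rparr>) C s \<sigma> = plays M C s \<sigma>"
  by (simp add: plays_def outcomes_def)

text \<open>Neither plays nor nominals depend on the valuation of \<open>p\<close>, so the cases for
  strategies and for \<open>At\<close> pass straight through the induction; \<open>\<chi>\<close> is
  always evaluated in the old model.\<close>

lemma sat_subst_prop:
  assumes "\<phi> \<in> HATL"
  shows "sat M s (subst_prop p \<chi> \<phi>) \<longleftrightarrow>
         sat (M\<lparr>label := (label M)(Inl p := {t. sat M t \<chi>})\<rparr>) s \<phi>"
  using assms by (induction \<phi> arbitrary: s) (simp_all add: HATL_def)

text \<open>The conjunct \<open>At a (Nom a)\<close> is redundant in named models; with it, elimination is correct in
  all models, including those where a nominal names several states.\<close>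

definition prop_after :: "'p \<Rightarrow> 'n \<Rightarrow> bool \<Rightarrow> ('g, 'c, 'p, 'n) formula" where
  "prop_after p a b =
     (if b then Neg (Conj (Neg (Prop p)) (Neg (Conj (Nom a) (At a (Nom a)))))
      else Conj (Prop p) (Neg (Conj (Nom a) (At a (Nom a)))))"

lemma prop_after_HATL: "prop_after p a b \<in> HATL"
  by (simp add: prop_after_def HATL_def)

text \<open>Brings the update into the form required by \<open>sat_subst_prop\<close>: the new
  extension of \<open>p\<close> is defined by a formula in the old model.\<close>

lemma assign_model_eq:
  fixes M :: "('g, 'c, 'p, 'n, 's) cgm"
  shows "assign_model M p a b =
     M\<lparr>label := (label M)(Inl p := {t. sat M t (prop_after p a b :: ('g, 'c, 'p, 'n) formula)})\<rparr>"
proof -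
  have sat: "sat M u (prop_after p a b :: ('g, 'c, 'p, 'n) formula) \<longleftrightarrow>
      (if label M (Inr a) = {u} then b else u \<in> label M (Inl p))" for u
    by (cases b) (auto simp: prop_after_def)
  show ?thesis
  proof (cases "is_singleton (label M (Inr a))")
    case True
    then obtain t where t: "label M (Inr a) = {t}" by (rule is_singletonE)
    have "(if b then insert t (label M (Inl p)) else label M (Inl p) - {t}) =
        {u. if {t} = {u} then b else u \<in> label M (Inl p)}"
      by auto
    then show ?thesis unfolding assign_model_def sat t by (simp add: Let_def)
  next
    case False
    then have "label M (Inr a) \<noteq> {u}" for u by (auto simp: is_singleton_def)
    then show ?thesis using False by (simp add: assign_model_def sat)
  qed
qed

text \<open>Subformulas are translated before substituting, so on inputs from \<open>SLAMB\<close>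
  the substitution only meets formulas of \<open>HATL\<close>.\<close>

primrec elim_assign :: "('g, 'c, 'p, 'n) formula \<Rightarrow> ('g, 'c, 'p, 'n) formula" where
  "elim_assign (Prop p) = Prop p"
| "elim_assign (Nom a) = Nom a"
| "elim_assign (At a \<phi>) = At a (elim_assign \<phi>)"
| "elim_assign (Neg \<phi>) = Neg (elim_assign \<phi>)"
| "elim_assign (Conj \<phi> \<psi>) = Conj (elim_assign \<phi>) (elim_assign \<psi>)"
| "elim_assign (Next C \<phi>) = Next C (elim_assign \<phi>)"
| "elim_assign (Until C \<psi> \<phi>) = Until C (elim_assign \<psi>) (elim_assign \<phi>)"
| "elim_assign (Release C \<psi> \<phi>) = Release C (elim_assign \<psi>) (elim_assign \<phi>)"
| "elim_assign (Assign p a \<psi> \<phi>) =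
     Neg (Conj
       (Neg (Conj (elim_assign \<psi>) (subst_prop p (prop_after p a True) (elim_assign \<phi>))))
       (Neg (Conj (Neg (elim_assign \<psi>)) (subst_prop p (prop_after p a False) (elim_assign \<phi>)))))"
| "elim_assign (Redirect a A b \<phi>) = Redirect a A b (elim_assign \<phi>)"

lemma elim_assign_HATL: "\<phi> \<in> SLAMB \<Longrightarrow> elim_assign \<phi> \<in> HATL"
proof (induction \<phi>)
  case (Assign p a \<psi> \<phi>)
  then have "elim_assign \<psi> \<in> HATL" "elim_assign \<phi> \<in> HATL"
    by (simp_all add: SLAMB_def)
  then show ?case
    using subst_prop_HATL[OF _ prop_after_HATL, of "elim_assign \<phi>"]
    by (simp add: HATL_def)
qed (simp_all add: HATL_def SLAMB_def)

lemma sat_elim_assign: "\<phi> \<in> SLAMB \<Longrightarrow> sat M s (elim_assign \<phi>) \<longleftrightarrow> sat M s \<phi>"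
proof (induction \<phi> arbitrary: M s)
  case (Assign p a \<psi> \<phi>)
  then have S: "\<psi> \<in> SLAMB" "\<phi> \<in> SLAMB" by (simp_all add: SLAMB_def)
  have "sat M s (subst_prop p (prop_after p a b) (elim_assign \<phi>)) \<longleftrightarrow>
        sat (assign_model M p a b) s \<phi>" for b
    unfolding sat_subst_prop[OF elim_assign_HATL[OF S(2)]] assign_model_eq[symmetric]
    using Assign.IH(2)[OF S(2)] .
  then show ?case using Assign.IH(1)[OF S(1)] by (cases "sat M s \<psi>") simp_all
qed (simp_all add: SLAMB_def)

lemma SLAMB_at_most_HATL: "SLAMB \<preceq> HATL"
  unfolding at_most_as_expressive_def equivalent_def
  by (auto simp: sat_elim_assign intro!: bexI[OF _ elim_assign_HATL])

subsection \<open>Renaming of actions\<close>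

definition rename_actions ::
  "('c \<Rightarrow> 'c) \<Rightarrow> ('g, 'c, 'p, 'n, 's) cgm \<Rightarrow> ('g, 'c, 'p, 'n, 's) cgm" where
  "rename_actions f M = M\<lparr>step := \<lambda>s A. step M s (f \<circ> A)\<rparr>"

lemma states_rename_actions [simp]: "states (rename_actions f M) = states M"
  and label_rename_actions [simp]: "label (rename_actions f M) = label M"
  by (simp_all add: rename_actions_def)

lemma named_cgm_rename_actions: "named_cgm M \<Longrightarrow> named_cgm (rename_actions f M)"
  by (simp add: named_cgm_def rename_actions_def)

text \<open>Surjectivity of \<open>f\<close> lets every profile \<open>B\<close> be written as
  \<open>f \<circ> (inv f \<circ> B)\<close>; injectivity makes \<open>inv f \<circ> B\<close> agree
  with \<open>A\<close> on \<open>C\<close>.\<close>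

lemma outcomes_rename_actions:
  assumes "bij f"
  shows "outcomes (rename_actions f M) C s A = outcomes M C s (f \<circ> A)"
proof (intro equalityI subsetI)
  fix x assume "x \<in> outcomes (rename_actions f M) C s A"
  then obtain B where B: "x = step M s (f \<circ> B)" "\<forall>i\<in>C. B i = A i"
    by (auto simp: outcomes_def rename_actions_def)
  then have "\<forall>i\<in>C. (f \<circ> B) i = (f \<circ> A) i" by simp
  then show "x \<in> outcomes M C s (f \<circ> A)"
    using B(1) unfolding outcomes_def by blast
next
  fix x assume "x \<in> outcomes M C s (f \<circ> A)"
  then obtain B where B: "x = step M s B" "\<forall>i\<in>C. B i = f (A i)"
    by (auto simp: outcomes_def)
  have "f \<circ> (inv f \<circ> B) = B" "\<forall>i\<in>C. (inv f \<circ> B) i = A i"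
    using B assms by (auto simp: fun_eq_iff bij_is_inj bij_is_surj surj_f_inv_f)
  then show "x \<in> outcomes (rename_actions f M) C s A"
    using B(1) unfolding outcomes_def rename_actions_def
    by (intro CollectI exI[of _ "inv f \<circ> B"]) simp
qed

lemma plays_rename_actions:
  assumes "bij f"
  shows "plays (rename_actions f M) C s \<sigma> = plays M C s (\<lambda>t. f \<circ> \<sigma> t)"
  by (simp add: plays_def outcomes_rename_actions[OF assms])

text \<open>Composition with \<open>f\<close> permutes the strategies, so both existential
  quantifiers range over the same sets of plays.\<close>

lemma strategy_rename_actions:
  assumes "bij f"
  shows "(\<exists>\<sigma>. \<forall>l\<in>plays (rename_actions f M) C s \<sigma>. P l) \<longleftrightarrow> (\<exists>\<sigma>. \<forall>l\<in>plays M C s \<sigma>. P l)"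
proof
  assume "\<exists>\<sigma>. \<forall>l\<in>plays M C s \<sigma>. P l"
  then obtain \<sigma> where \<sigma>: "\<forall>l\<in>plays M C s \<sigma>. P l" ..
  have "(\<lambda>t. f \<circ> (inv f \<circ> \<sigma> t)) = \<sigma>"
    using assms by (simp add: fun_eq_iff bij_is_surj surj_f_inv_f)
  then have "\<forall>l\<in>plays (rename_actions f M) C s (\<lambda>t. inv f \<circ> \<sigma> t). P l"
    using \<sigma> by (simp add: plays_rename_actions[OF assms])
  then show "\<exists>\<sigma>. \<forall>l\<in>plays (rename_actions f M) C s \<sigma>. P l" by blast
qed (auto simp: plays_rename_actions[OF assms])

lemma HATL_rename_actions:
  assumes "bij f" "\<phi> \<in> HATL"
  shows "sat (rename_actions f M) s \<phi> \<longleftrightarrow> sat M s \<phi>"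
  using assms(2)
  by (induction \<phi> arbitrary: s) (simp_all add: HATL_def strategy_rename_actions[OF assms(1)])

subsection \<open>A redirection that is not expressible\<close>

lemma outcomes_UNIV: "outcomes M UNIV s A = {step M s A}"
proof -
  have "(\<forall>i\<in>UNIV. B i = A i) \<longleftrightarrow> B = A" for B by (simp add: fun_eq_iff)
  then show ?thesis by (simp add: outcomes_def)
qed

lemma sat_Next_UNIV: "sat M s (Next UNIV \<phi>) \<longleftrightarrow> (\<exists>A. sat M (step M s A) \<phi>)"
proof
  assume "sat M s (Next UNIV \<phi>)"
  then obtain \<sigma> where \<sigma>: "\<forall>l\<in>plays M UNIV s \<sigma>. sat M (l 1) \<phi>" by auto
  \<comment> \<open>Iterating the strategy gives a play, so the universal quantifier over plays is
    not vacuous.\<close>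
  have "(\<lambda>i. ((\<lambda>t. step M t (\<sigma> t)) ^^ i) s) \<in> plays M UNIV s \<sigma>"
    by (simp add: plays_def outcomes_UNIV)
  then show "\<exists>A. sat M (step M s A) \<phi>" using \<sigma> by (intro exI[of _ "\<sigma> s"]) auto
next
  assume "\<exists>A. sat M (step M s A) \<phi>"
  then obtain A where A: "sat M (step M s A) \<phi>" ..
  have "\<forall>l\<in>plays M UNIV s (\<lambda>_. A). sat M (l 1) \<phi>"
    using A by (auto simp: plays_def outcomes_UNIV)
  then show "sat M s (Next UNIV \<phi>)" unfolding sat.simps by blast
qed

text \<open>In the model below, the only transition from \<open>0\<close> to \<open>1\<close> is the one where all agents play
  \<open>a\<close>. Redirecting it disconnects \<open>1\<close>, unless the actions \<open>a\<close> and \<open>b\<close> have been swapped.\<close>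

lemma ALAMB_not_at_most_HATL:
  assumes "card (UNIV :: 'c set) \<ge> 2"
  shows "\<not> (ALAMB :: ('g, 'c, 'p, 'n::infinite) formula set) \<preceq> HATL"
proof
  assume le: "(ALAMB :: ('g, 'c, 'p, 'n) formula set) \<preceq> HATL"
  obtain a b :: 'c where ab: "a \<noteq> b"
    using assms card_le_Suc0_iff_eq[OF card_ge_0_finite, of "UNIV :: 'c set"] by auto
  obtain m n :: 'n where mn: "m \<noteq> n"
    using ex_new_if_finite[OF infinite_UNIV, of "{undefined :: 'n}"] by auto
  \<comment> \<open>The redirection turns one transition of the state named \<open>m\<close> into a
    loop; the rest asks whether some profile still leads to \<open>n\<close>.\<close>
  define \<phi> :: "('g, 'c, 'p, 'n) formula" where
    "\<phi> = Redirect m (\<lambda>_. a) m (Next UNIV (Nom n))"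
  define M :: "('g, 'c, 'p, 'n, nat) cgm" where
    "M = \<lparr>states = {0, 1},
          step = (\<lambda>s A. if s = 0 \<and> A \<noteq> (\<lambda>_. a) then 0 else 1),
          label = (\<lambda>x. if x = Inr m then {0} else if x = Inr n then {1} else {})\<rparr>"
  define f where "f = id(a := b, b := a)"
  have "f (f c) = c" for c by (simp add: f_def)
  then have f: "bij f" by (rule involuntory_imp_bij)
  have M_states: "states M = {0, 1}" by (simp add: M_def)
  have lab: "label M (Inr m) = {0}" "label M (Inr n) = {1}"
    using mn by (simp_all add: M_def)
  have M: "named_cgm M"
    unfolding named_cgm_def
  proof (intro conjI ballI)
    fix s assume "s \<in> states M"
    then show "\<exists>c. label M (Inr c) = {s}" using lab M_states by auto
  qed (simp_all add: M_def)
  have "\<phi> \<in> ALAMB" by (simp add: \<phi>_def ALAMB_def)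
  then obtain \<psi> where \<psi>: "\<psi> \<in> HATL" "equivalent \<phi> \<psi>"
    using le unfolding at_most_as_expressive_def by blast
  have eq: "sat N 0 \<psi> \<longleftrightarrow> sat N 0 \<phi>" if "named_cgm N" "states N = {0, 1}"
    for N :: "('g, 'c, 'p, 'n, nat) cgm"
    using \<psi>(2) that unfolding equivalent_def by simp
  \<comment> \<open>After the update the profile of all \<open>a\<close> loops at \<open>0\<close>,
    so only another profile can reach \<open>1\<close>.\<close>
  have redirect: "sat N 0 \<phi> \<longleftrightarrow> (\<exists>A. A \<noteq> (\<lambda>_. a) \<and> step N 0 A = 1)"
    if "label N = label M" for N :: "('g, 'c, 'p, 'n, nat) cgm"
    unfolding \<phi>_def sat.simps(10) sat_Next_UNIV using that lab
    by (simp add: redirect_model_def Let_def cong: conj_cong)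
  have "\<not> sat M 0 \<phi>"
    unfolding redirect[OF refl] by (simp add: M_def)
  moreover have "sat (rename_actions f M) 0 \<phi>"
    unfolding redirect[OF label_rename_actions]
  proof (intro exI conjI)
    \<comment> \<open>The swap \<open>f\<close> sends the profile of all \<open>b\<close> to that of
      all \<open>a\<close>, the one leading to \<open>1\<close> in \<open>M\<close>.\<close>
    show "(\<lambda>_ :: 'g. b) \<noteq> (\<lambda>_. a)" using ab by (simp add: fun_eq_iff)
    show "step (rename_actions f M) 0 (\<lambda>_. b) = 1"
      using ab by (simp add: rename_actions_def M_def f_def comp_def)
  qed
  ultimately show False
    using HATL_rename_actions[OF f \<psi>(1), of M 0] eq[OF M] eq[OF named_cgm_rename_actions[OF M]]
    by (simp add: M_states)
qed

theorem theorem4p2: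
  shows "((HATL :: ('g::finite, 'c::finite, 'p::{countable,infinite}, 'n::{countable,infinite}) formula set)
             \<preceq> ALAMB \<and>
          (SLAMB :: ('g, 'c, 'p, 'n) formula set) \<preceq> ALAMB) \<and>
         (card (UNIV :: 'c set) \<ge> 2 \<longrightarrow>
            (HATL :: ('g, 'c, 'p, 'n) formula set) \<prec> ALAMB \<and>
            (SLAMB :: ('g, 'c, 'p, 'n) formula set) \<prec> ALAMB)"
proof -
  have H: "(HATL :: ('g, 'c, 'p, 'n) formula set) \<preceq> ALAMB"
    by (rule at_most_as_expressive_mono) (auto simp: HATL_def ALAMB_def)
  then have S: "(SLAMB :: ('g, 'c, 'p, 'n) formula set) \<preceq> ALAMB"
    by (rule at_most_as_expressive_trans[OF SLAMB_at_most_HATL])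
  have "\<not> (ALAMB :: ('g, 'c, 'p, 'n) formula set) \<preceq> HATL \<and>
        \<not> (ALAMB :: ('g, 'c, 'p, 'n) formula set) \<preceq> SLAMB" if "card (UNIV :: 'c set) \<ge> 2"
    \<comment> \<open>A translation of \<open>ALAMB\<close> into \<open>SLAMB\<close> would compose
      with the elimination of assignments into one into \<open>HATL\<close>.\<close>
    using ALAMB_not_at_most_HATL[OF that] at_most_as_expressive_trans[OF _ SLAMB_at_most_HATL]
    by metis
  then show ?thesis using H S by (simp add: less_expressive_def)
qed

end
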